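(* Fix an integer $m\geq3$. Then the number $p_{m,n}$ of inequivalent integer $m$-gons with perimeter $n$ satisfies \[p_{m,n}\sim \frac{2^{m-1}-m}{2^m\, m!}\,n^{m-1}\qquad\text{as } n\to\infty.\]
   Context: An integer $m$-gon is a polygon with $m$ sides whose side lengths are all positive integers; its perimeter is the sum of the side lengths. Reading the side lengths starting from any side, clockwise or anticlockwise, gives an $m$-tuple; two $m$-gons are equivalent if the $m$-tuple of one can be obtained from that of the other by cyclically re-ordering and/or reversing the entries. (Side-length tuples of integer $m$-gons of perimeter $n$ are exactly $m$-tuples of positive integers summing to $n$ with every entry less than $n/2$.) $f\sim g$ means $f/g\to1$. *)

theory Defs
  imports "HOL-Analysis.Analysis" "HOL-Library.Landau_Symbols"
begin

text \<open>
  A polygon in the Euclidean plane (the complex numbers) is the list of its vertices in the order in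
  which they are traversed, with some choice of starting vertex and direction.  The last condition
  excludes straight angles, so that a list of length m has exactly m sides.
\<close>

definition vertex :: "complex list \<Rightarrow> nat \<Rightarrow> complex" where
  "vertex P i = P ! (i mod length P)"

definition polygon :: "complex list \<Rightarrow> bool" where
  "polygon P \<longleftrightarrow> length P \<ge> 3 \<and> distinct P \<and>
     (\<forall>i<length P. \<forall>j<length P. i \<noteq> j \<longrightarrow>
        closed_segment (vertex P i) (vertex P (i + 1)) \<inter> closed_segment (vertex P j) (vertex P (j + 1))
          = {vertex P i, vertex P (i + 1)} \<inter> {vertex P j, vertex P (j + 1)}) \<and>
     (\<forall>i<length P. \<not> collinear {vertex P i, vertex P (i + 1), vertex P (i + 2)})"

definition side_lengths :: "complex list \<Rightarrow> real list" where
  "side_lengths P = map (\<lambda>i. dist (vertex P i) (vertex P (i + 1))) [0..<length P]"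

definition perimeter :: "complex list \<Rightarrow> real" where
  "perimeter P = sum_list (side_lengths P)"

definition integer_gons :: "nat \<Rightarrow> nat \<Rightarrow> complex list set" where
  "integer_gons m n =
     {P. polygon P \<and> length P = m \<and> (\<forall>a\<in>set (side_lengths P). a \<in> \<int> \<and> a > 0) \<and> perimeter P = real n}"

definition gon_equivalent :: "complex list \<Rightarrow> complex list \<Rightarrow> bool" where
  "gon_equivalent P Q \<longleftrightarrow>
     (\<exists>k. side_lengths Q = rotate k (side_lengths P) \<or> side_lengths Q = rotate k (rev (side_lengths P)))"

definition num_gons :: "nat \<Rightarrow> nat \<Rightarrow> nat" where
  "num_gons m n =
     card (integer_gons m n // {(P, Q). P \<in> integer_gons m n \<and> Q \<in> integer_gons m n \<and> gon_equivalent P Q})"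

end

theory Submission imports Defs begin

text \<open>
  By the triangle inequality no side exceeds half of the perimeter; conversely, positive tuples whose
  entries are all less than n/2 are realised, after a rotation, by polygons inscribed in a circle.
  Hence the number of classes is the number of dihedral orbits on the tuples of sum n with all
  entries at most n/2, up to orbits of tuples that have two equal entries, a zero entry or an entry
  n/2.  The latter satisfy an additional linear equation, so there are O(n^(m-2)) of them; the other
  orbits have exactly 2m elements.  Finally, at most one entry of a tuple exceeds n/2, so the tuples
  to be counted number C(n+m-1, m-1) - m C(n/2+m-2, m-1) up to rounding, which is asymptotic to
  (1 - m / 2^(m-1)) n^(m-1) / (m-1)!.
\<close>

section \<open>Cyclic polygons\<close>

text \<open>Twice the signed area of the triangle \<open>a b c\<close>, positive when the triangle
  is traversed counterclockwise.\<close>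

definition orient :: "complex \<Rightarrow> complex \<Rightarrow> complex \<Rightarrow> real" where
  "orient a b c = Im (cnj (b - a) * (c - a))"

lemma orient_degenerate [simp]:
  "orient a a c = 0" "orient a b a = 0" "orient a b b = 0"
  by (auto simp: orient_def algebra_simps)

lemma orient_cyclic: "orient b c a = orient a b c"
  by (simp add: orient_def algebra_simps)

lemma orient_affine:
  "orient a b ((1 - u) *\<^sub>R c + u *\<^sub>R d) = (1 - u) * orient a b c + u * orient a b d"
  by (simp add: orient_def algebra_simps)

lemma orient_eq_0_if_collinear:
  assumes "collinear {a, b, c}"
  shows "orient a b c = 0"
proof -
  from assms consider "a = c" | u where "b = u *\<^sub>R a + (1 - u) *\<^sub>R c"
    unfolding collinear_3_expand by blast
  then show ?thesis
  proof cases
    case 2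
    then have "b - a = (1 - u) *\<^sub>R (c - a)" by (simp add: algebra_simps)
    then show ?thesis unfolding orient_def by simp (simp add: algebra_simps)
  qed simp
qed

text \<open>For every side, all other vertices lie strictly to the left of its line; a common point of two
  sides therefore has to be a common vertex.\<close>
lemma polygon_if_convex_position:
  assumes len: "length P \<ge> 3"
    and pos: "\<And>i j k. i < j \<Longrightarrow> j < k \<Longrightarrow> k < length P \<Longrightarrow> orient (P ! i) (P ! j) (P ! k) > 0"
  shows "polygon P"
proof -
  define m where "m = length P"
  have m: "m \<ge> 3" using len m_def by simp
  let ?v = "vertex P"
  \<comment> \<open>The assumption \<open>pos\<close> treats increasing indices only. Cyclic
    invariance of \<open>orient\<close> covers a third vertex that precedes the side, and the
    closing side from \<open>m - 1\<close> to 0.\<close>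
  have side_pos: "orient (?v i) (?v (i + 1)) (?v k) > 0"
    if "i < m" "k mod m \<noteq> i" "k mod m \<noteq> (i + 1) mod m" for i k
  proof -
    define l where "l = k mod m"
    have l: "l < m" "l \<noteq> i" "l \<noteq> (i + 1) mod m" using that m unfolding l_def by auto
    have vl: "?v k = P ! l" and vi: "?v i = P ! i"
      using that by (auto simp: vertex_def l_def m_def)
    show ?thesis
    proof (cases "i + 1 < m")
      case True
      then have vi1: "?v (i + 1) = P ! (i + 1)" by (auto simp: vertex_def m_def)
      show ?thesis
      proof (cases "l < i")
        case True
        then show ?thesis
          using pos[of l i "i + 1"] \<open>i + 1 < m\<close> unfolding vl vi vi1 m_def
          by (simp add: orient_cyclic[of "P ! i" _ "P ! l"])
      next
        case False
        then have "i + 1 < l" using l True by (metis Suc_eq_plus1 linorder_neqE_nat mod_less not_less_eq)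
        then show ?thesis
          using pos[of i "i + 1" l] l unfolding vl vi vi1 m_def by simp
      qed
    next
      case False
      then have "i + 1 = m" using that(1) by simp
      then have i: "i = m - 1" "(i + 1) mod m = 0" by auto
      then have vi1: "?v (i + 1) = P ! 0" by (auto simp: vertex_def m_def)
      have "0 < l" "l < i" using l i by auto
      then show ?thesis
        using pos[of 0 l i] that(1) unfolding vl vi vi1 m_def
        by (simp add: orient_cyclic[of "P ! 0" _ "P ! i", symmetric])
    qed
  qed
  have zero_iff: "orient (?v i) (?v (i + 1)) (?v k) = 0 \<longleftrightarrow> k mod m = i \<or> k mod m = (i + 1) mod m"
    and nonneg: "orient (?v i) (?v (i + 1)) (?v k) \<ge> 0"
    if "i < m" for i k
  proof -
    have "?v k = ?v (k mod m)" "?v (i + 1) = ?v ((i + 1) mod m)"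
      by (auto simp: vertex_def m_def)
    then have *: "orient (?v i) (?v (i + 1)) (?v k) = 0" if "k mod m = i \<or> k mod m = (i + 1) mod m"
      using that by auto
    with side_pos[OF that, of k]
    show "orient (?v i) (?v (i + 1)) (?v k) = 0 \<longleftrightarrow> k mod m = i \<or> k mod m = (i + 1) mod m"
      and "orient (?v i) (?v (i + 1)) (?v k) \<ge> 0"
      by force+
  qed
  have mod_facts: "(i + 1) mod m \<noteq> i" "(i + 2) mod m \<noteq> i" "(i + 2) mod m \<noteq> (i + 1) mod m"
    if "i < m" for i
    using that m by (auto simp: mod_if)
  have third: "orient (?v i) (?v (i + 1)) (?v (i + 2)) > 0" if "i < m" for i
    using side_pos[OF that, of "i + 2"] mod_facts[OF that] by blast
  \<comment> \<open>A vertex equal to \<open>P ! i\<close> lies on the line of side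
    \<open>i\<close>, so it has to be the other end of that side. The side then degenerates, against
    \<open>third\<close>.\<close>
  have "P ! i \<noteq> P ! k" if "i < k" "k < m" for i k
  proof
    assume eq: "P ! i = P ! k"
    have v: "?v i = P ! i" "?v k = P ! k" using that by (auto simp: vertex_def m_def)
    have "orient (?v i) (?v (i + 1)) (?v k) = 0" using eq v by simp
    then have "k = (i + 1) mod m" using zero_iff[of i k] that by auto
    then have "?v (i + 1) = ?v i" using eq v by (simp add: vertex_def m_def)
    then show False using third[of i] that by simp
  qed
  then have dist: "distinct P"
    unfolding distinct_conv_nth m_def by (metis linorder_neqE_nat)
  \<comment> \<open>\<open>?f\<close> is non-negative at both ends of side \<open>j\<close> and
    vanishes at \<open>z\<close>. Hence \<open>z\<close> is an end, or both ends lie on the line of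
    side \<open>i\<close>; the latter would give \<open>(i + 2) mod m = i\<close>, impossible for
    \<open>m \<ge> 3\<close>.\<close>
  have meet: "z = ?v j \<or> z = ?v (j + 1)"
    if ij: "i < m" "j < m" "i \<noteq> j"
      and z: "z \<in> closed_segment (?v i) (?v (i + 1))" "z \<in> closed_segment (?v j) (?v (j + 1))"
    for i j z
  proof -
    let ?f = "orient (?v i) (?v (i + 1))"
    obtain u where u: "0 \<le> u" "u \<le> 1" "z = (1 - u) *\<^sub>R ?v j + u *\<^sub>R ?v (j + 1)"
      using z(2) by (auto simp: in_segment)
    have "?f z = 0" using z(1) by (auto simp: in_segment orient_affine)
    then have *: "(1 - u) * ?f (?v j) + u * ?f (?v (j + 1)) = 0"
      using u(3) orient_affine by simp
    have "0 \<le> (1 - u) * ?f (?v j)" "0 \<le> u * ?f (?v (j + 1))"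
      using u nonneg[OF ij(1)] by auto
    with * have "(1 - u) * ?f (?v j) = 0" "u * ?f (?v (j + 1)) = 0" by linarith+
    then consider "u = 1" | "u = 0" | "?f (?v j) = 0" "?f (?v (j + 1)) = 0" by force
    then show ?thesis
    proof cases
      case 3
      then have "j = (i + 1) mod m" "(j + 1) mod m = i \<or> (j + 1) mod m = j"
        using zero_iff[OF ij(1)] ij by auto
      then have "(i + 2) mod m = i"
        using mod_facts[OF ij(2)] by (metis add.assoc mod_add_left_eq one_add_one)
      then show ?thesis using mod_facts[OF ij(1)] by blast
    qed (use u in auto)
  qed
  show ?thesis
    unfolding polygon_def
  proof (intro conjI allI impI)
    fix i j assume "i < length P" "j < length P" "i \<noteq> j"
    then show "closed_segment (?v i) (?v (i + 1)) \<inter> closed_segment (?v j) (?v (j + 1))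
        = {?v i, ?v (i + 1)} \<inter> {?v j, ?v (j + 1)}"
      using meet[of i j] meet[of j i] unfolding m_def by auto
  next
    fix i assume "i < length P"
    then show "\<not> collinear {?v i, ?v (i + 1), ?v (i + 2)}"
      using third[of i] orient_eq_0_if_collinear unfolding m_def by force
  qed (use len dist in auto)
qed

section \<open>Points on a circle and the existence of a circumradius\<close>

text \<open>Points are parametrised by half of their polar angle, so that chord lengths become sines
  of differences.\<close>

lemma dist_cis_double: "dist (cis (2 * s)) (cis (2 * t)) = 2 * \<bar>sin (t - s)\<bar>"
proof -
  have "(dist (cis (2 * s)) (cis (2 * t)))\<^sup>2
      = (cos (2 * s) - cos (2 * t))\<^sup>2 + (sin (2 * s) - sin (2 * t))\<^sup>2"
    by (simp add: dist_norm cmod_power2)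
  also have "\<dots> = 2 - 2 * cos (2 * (t - s))"
    using sin_cos_squared_add[of "2 * s"] sin_cos_squared_add[of "2 * t"]
    by (simp add: cos_diff right_diff_distrib power2_diff algebra_simps)
  also have "\<dots> = (2 * \<bar>sin (t - s)\<bar>)\<^sup>2"
    by (subst cos_double_sin) (simp add: power_mult_distrib)
  finally show ?thesis
    by (subst (asm) power2_eq_iff_nonneg) auto
qed

text \<open>The differences \<open>t - s\<close>, \<open>u - t\<close> and the supplement of
  \<open>u - s\<close> are the inscribed angles of the triangle when
  \<open>s < t < u < s + pi\<close>; this is the area formula by circumradius and sines of the
  angles. Convex position thereby reduces to positivity of sines.\<close>

lemma orient_cis_double:
  "orient (R *\<^sub>R cis (2 * s)) (R *\<^sub>R cis (2 * t)) (R *\<^sub>R cis (2 * u))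
     = 4 * R\<^sup>2 * sin (t - s) * sin (u - t) * sin (u - s)"
proof -
  define x y where "x = t - s" and "y = u - t"
  have "orient (R *\<^sub>R cis (2 * s)) (R *\<^sub>R cis (2 * t)) (R *\<^sub>R cis (2 * u))
      = R\<^sup>2 * (sin (2 * t - 2 * s) + sin (2 * u - 2 * t) - sin (2 * u - 2 * s))"
    unfolding sin_diff by (simp add: orient_def algebra_simps power2_eq_square)
  also have "\<dots> = R\<^sup>2 * (sin (2 * x) + sin (2 * y) - sin (2 * x + 2 * y))"
    by (simp add: x_def y_def algebra_simps)
  also have "sin (2 * x) + sin (2 * y) - sin (2 * x + 2 * y)
      = sin (2 * x) * (1 - cos (2 * y)) + sin (2 * y) * (1 - cos (2 * x))"
    by (simp add: sin_add algebra_simps)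
  also have "\<dots> = 4 * sin x * sin y * (sin x * cos y + cos x * sin y)"
    unfolding cos_double_sin sin_double by (simp add: algebra_simps power2_eq_square)
  also have "\<dots> = 4 * sin x * sin y * sin (x + y)"
    by (simp add: sin_add)
  finally show ?thesis
    by (simp add: x_def y_def)
qed

text \<open>Here \<open>\<kappa>\<close> is the reciprocal of the diameter and \<open>2 arcsin (\<kappa> * a i)\<close> the central angle over the
  chord \<open>a i\<close>.  For small \<open>\<kappa>\<close> the chord closing the chain is almost the sum of the \<open>a i\<close>, hence longer
  than \<open>L\<close>; it is at most \<open>L\<close> once \<open>\<kappa>\<close> is so large that the chain goes round the whole circle or that
  some \<open>a i\<close> is a diameter.\<close>
lemma circumradius_exists:
  fixes a :: "nat \<Rightarrow> real"
  assumes "M \<ge> 1"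
    and pos: "\<And>i. i < M \<Longrightarrow> a i > 0"
    and le: "\<And>i. i < M \<Longrightarrow> a i \<le> L"
    and L: "L < (\<Sum>i<M. a i)"
  obtains \<kappa> where "\<kappa> > 0" "\<And>i. i < M \<Longrightarrow> \<kappa> * a i \<le> 1"
    "(\<Sum>i<M. arcsin (\<kappa> * a i)) < pi" "sin (\<Sum>i<M. arcsin (\<kappa> * a i)) = \<kappa> * L"
proof -
  \<comment> \<open>\<open>1 / b\<close> is the largest \<open>\<kappa>\<close> for which every
    argument \<open>\<kappa> * a i\<close> stays in the domain of \<open>arcsin\<close>.\<close>
  define b where "b = Max (a ` {..<M})"
  have ne: "a ` {..<M} \<noteq> {}" using assms(1) by (auto simp: lessThan_empty_iff)
  have ab: "a i \<le> b" if "i < M" for i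
    unfolding b_def using that by (intro Max_ge) auto
  have "b \<in> a ` {..<M}" unfolding b_def using ne by (intro Max_in) auto
  then have b: "0 < b" "b \<le> L" using pos le by auto
  have bd: "-1 \<le> x * a i" "x * a i \<le> 1" if "0 \<le> x" "x \<le> 1 / b" "i < M" for x i
  proof -
    have "x * a i \<le> (1 / b) * b" using that ab pos[of i] b by (intro mult_mono) auto
    then show "x * a i \<le> 1" using b by simp
    show "-1 \<le> x * a i" using that pos[of i] by (smt (verit) mult_nonneg_nonneg)
  qed
  define S where "S = (\<lambda>x. \<Sum>i<M. arcsin (x * a i))"
  define g where "g = (\<lambda>x. sin (S x) - x * L)"
  have contS: "continuous_on {0..1 / b} S"
    unfolding S_def using bd by (intro continuous_intros) auto
  have contg: "continuous_on {0..1 / b} g"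
    unfolding g_def by (intro continuous_intros contS)
  have monoS: "S x \<le> S y" if "0 \<le> x" "x \<le> y" "y \<le> 1 / b" for x y
    unfolding S_def
  proof (rule sum_mono)
    fix i assume "i \<in> {..<M}"
    then show "arcsin (x * a i) \<le> arcsin (y * a i)"
      using bd[of x i] bd[of y i] that pos[of i] by (intro arcsin_le_arcsin mult_right_mono) auto
  qed
  have S0: "S 0 = 0" by (simp add: S_def)
  \<comment> \<open>Since \<open>arcsin\<close> and \<open>sin\<close> have slope 1 at 0,
    \<open>g\<close> has slope \<open>(\<Sum>i<M. a i) - L > 0\<close> there, and so is positive
    just to the right of 0.\<close>
  have "(S has_real_derivative (\<Sum>i<M. a i)) (at 0)"
    unfolding S_def by (auto intro!: derivative_eq_intros)
  then have "(g has_real_derivative (\<Sum>i<M. a i) - L) (at 0)"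
    unfolding g_def by (auto intro!: derivative_eq_intros simp: S0)
  then obtain d where d: "d > 0" "\<And>h. 0 < h \<Longrightarrow> h < d \<Longrightarrow> g 0 < g (0 + h)"
    using L DERIV_pos_inc_right[of g "(\<Sum>i<M. a i) - L" 0] by auto
  have g_pos: "g h > 0" if "0 < h" "h < d" for h
    using d(2)[OF that] by (simp add: g_def S0)
  \<comment> \<open>If \<open>S\<close> stays at most \<open>pi\<close>, take \<open>1 / b\<close>:
    by \<open>b \<le> L\<close> the subtracted term is at least 1 and outweighs the sine. Otherwise
    take a point where \<open>S\<close> equals \<open>pi\<close> and the sine vanishes.\<close>
  obtain k where k: "0 < k" "k \<le> 1 / b" "S k \<le> pi" "g k \<le> 0"
  proof (cases "S (1 / b) \<le> pi")
    case True
    have "g (1 / b) \<le> 0"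
      using sin_le_one[of "S (1 / b)"] b by (simp add: g_def) (simp add: order_trans[of _ 1])
    then show ?thesis using that[of "1 / b"] b True by auto
  next
    case False
    then obtain x where x: "0 \<le> x" "x \<le> 1 / b" "S x = pi"
      using IVT'[of S 0 pi "1 / b"] contS b S0 by auto
    moreover have "x \<noteq> 0" using x S0 by auto
    moreover have "g x \<le> 0" using x b by (simp add: g_def)
    ultimately show ?thesis using that[of x] by auto
  qed
  define h where "h = min (d / 2) k"
  have h: "0 < h" "h < d" "h \<le> k" using d k by (auto simp: h_def)
  have "continuous_on {h..k} g"
    by (rule continuous_on_subset[OF contg]) (use h k in auto)
  then obtain x where x: "h \<le> x" "x \<le> k" "g x = 0"
    using IVT2'[of g k 0 h] g_pos[OF h(1,2)] k(4) h(3) by auto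
  \<comment> \<open>Equality is excluded because \<open>sin (S x) = x * L\<close> is
    positive.\<close>
  have "S x \<le> pi" using monoS[of x k] x h k by auto
  moreover have sinS: "sin (S x) = x * L" using x by (simp add: g_def)
  moreover have "x * L > 0" using x h b by (intro mult_pos_pos) auto
  ultimately have "S x < pi" by (metis less_eq_real_def less_irrefl sin_pi)
  then show thesis
    using that[of x] sinS x h k bd[of x] unfolding S_def by auto
qed

text \<open>All sides but the last are laid off as consecutive chords of a circle of diameter
  \<open>1 / \<kappa>\<close>; the choice of \<open>\<kappa>\<close> gives the closing chord the
  length of the last side. Having the longest side last meets the bound \<open>a i \<le> L\<close>
  of \<open>circumradius_exists\<close>.\<close>

lemma cyclic_polygon_exists:
  fixes as :: "real list"
  assumes len: "length as \<ge> 3"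
    and pos: "\<And>x. x \<in> set as \<Longrightarrow> x > 0"
    and le: "\<And>x. x \<in> set as \<Longrightarrow> x \<le> last as"
    and L: "2 * last as < sum_list as"
  obtains P where "polygon P" "side_lengths P = as"
proof -
  define M where "M = length as - 1"
  have M: "M \<ge> 2" "length as = Suc M" using len by (auto simp: M_def)
  have last: "last as = as ! M" using len by (simp add: last_conv_nth M_def flip: length_greater_0_conv)
  have "sum_list as = (\<Sum>i<M. as ! i) + as ! M"
    by (simp add: sum_list_sum_nth M atLeast0LessThan)
  with L last have "last as < (\<Sum>i<M. as ! i)" by simp
  then obtain \<kappa> where \<kappa>: "\<kappa> > 0" "\<And>i. i < M \<Longrightarrow> \<kappa> * as ! i \<le> 1"
    "(\<Sum>i<M. arcsin (\<kappa> * as ! i)) < pi" "sin (\<Sum>i<M. arcsin (\<kappa> * as ! i)) = \<kappa> * last as"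
    using circumradius_exists[of M "(!) as" "last as"] M pos le by auto
  \<comment> \<open>\<open>S k\<close> is half of the polar angle of vertex \<open>k\<close>. These
    values increase from 0 to less than \<open>pi\<close>, so all their differences have positive
    sine.\<close>
  define S where "S = (\<lambda>k. \<Sum>i<k. arcsin (\<kappa> * as ! i))"
  define R where "R = 1 / (2 * \<kappa>)"
  define P where "P = map (\<lambda>k. R *\<^sub>R cis (2 * S k)) [0..<Suc M]"
  have R: "R > 0" using \<kappa> by (simp add: R_def)
  have lenP: "length P = Suc M" by (simp add: P_def)
  have nthP: "P ! k = R *\<^sub>R cis (2 * S k)" if "k \<le> M" for k
    using that unfolding P_def by (subst nth_map_upt) auto
  have prod_pos: "\<kappa> * as ! i > 0" if "i < M" for i
    using that \<kappa>(1) pos M by (intro mult_pos_pos) auto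
  have step: "S k < S (Suc k)" if "k < M" for k
  proof -
    have "arcsin 0 < arcsin (\<kappa> * as ! k)"
      using prod_pos[OF that] \<kappa>(2)[OF that] by (intro arcsin_less_arcsin) auto
    then show ?thesis by (simp add: S_def)
  qed
  have S_less: "S i < S j" if "i < j" "j \<le> M" for i j
    using that
  proof (induction j)
    case (Suc j)
    then show ?case using step[of j] by (cases "i = j") auto
  qed simp
  have S0: "S 0 = 0" and SM: "S M < pi" using \<kappa>(3) by (auto simp: S_def)
  have sin_pos: "sin (S j - S i) > 0" if "i < j" "j \<le> M" for i j
  proof -
    have "0 \<le> S i" using S_less[of 0 i] that S0 by (cases "i = 0") auto
    moreover have "S j \<le> S M" using S_less[of j M] that by (cases "j = M") auto
    ultimately show ?thesis using S_less[OF that] SM by (intro sin_gt_zero) auto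
  qed
  have dist: "dist (P ! i) (P ! j) = sin (S j - S i) / \<kappa>" if "i < j" "j \<le> M" for i j
  proof -
    have "dist (P ! i) (P ! j) = R * dist (cis (2 * S i)) (cis (2 * S j))"
      using that R by (simp add: nthP dist_norm flip: scaleR_diff_right)
    also have "\<dots> = sin (S j - S i) / \<kappa>"
      using sin_pos[OF that] unfolding dist_cis_double by (simp add: R_def)
    finally show ?thesis .
  qed
  have "polygon P"
  proof (rule polygon_if_convex_position)
    fix i j k assume "i < j" "j < k" "k < length P"
    then show "orient (P ! i) (P ! j) (P ! k) > 0"
      using R sin_pos by (simp add: nthP lenP orient_cis_double)
  qed (use lenP M in simp)
  moreover have "side_lengths P = as"
  proof (rule nth_equalityI)
    show "length (side_lengths P) = length as" by (simp add: side_lengths_def lenP M)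
    fix i assume "i < length (side_lengths P)"
    then have i: "i \<le> M" by (simp add: side_lengths_def lenP)
    then have *: "side_lengths P ! i = dist (P ! i) (P ! (Suc i mod Suc M))"
      unfolding side_lengths_def by (subst nth_map_upt) (auto simp: lenP vertex_def)
    show "side_lengths P ! i = as ! i"
    proof (cases "i = M")
      case True
      then have "side_lengths P ! i = dist (P ! 0) (P ! M)" using * by (simp add: dist_commute)
      also have "\<dots> = sin (S M) / \<kappa>" using dist[of 0 M] M S0 by simp
      also have "\<dots> = as ! i" using \<kappa> last True by (simp add: S_def)
      finally show ?thesis .
    next
      case False
      then have "i < M" using i by simp
      then have "side_lengths P ! i = sin (S (Suc i) - S i) / \<kappa>"
        using * dist[of i "Suc i"] by simp
      also have "S (Suc i) - S i = arcsin (\<kappa> * as ! i)" by (simp add: S_def)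
      also have "sin \<dots> = \<kappa> * as ! i"
        using prod_pos \<kappa>(2) \<open>i < M\<close> by (intro sin_arcsin) (smt (verit), auto)
      finally show ?thesis using \<kappa>(1) by simp
    qed
  qed
  ultimately show thesis using that by blast
qed

section \<open>Dihedral orbits of lists\<close>

definition dihedral_orbit :: "'a list \<Rightarrow> 'a list set" where
  "dihedral_orbit xs = {ys. \<exists>k. ys = rotate k xs \<or> ys = rotate k (rev xs)}"

text \<open>Reversal conjugates a rotation into its inverse, which keeps orbits closed under further
  rotations and reversals.\<close>

lemma rev_rotate: "rev (rotate k xs) = rotate (length xs - k mod length xs) (rev xs)"
  using rotate_rev[of k "rev xs"] by simp

text \<open>For a non-empty list, \<open>k * length xs - k\<close> is a natural number congruent to
  \<open>-k\<close> modulo the length.\<close>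

lemma rotate_inverse: "rotate (k * length xs - k) (rotate k xs) = xs"
proof (cases "xs = []")
  case False
  then have "k * length xs - k + k = k * length xs" by (cases xs) auto
  then show ?thesis by (simp add: rotate_rotate rotate_conv_mod[of "k * length xs"])
qed simp

lemma dihedral_orbit_self [simp]: "xs \<in> dihedral_orbit xs"
  unfolding dihedral_orbit_def by (auto intro: exI[of _ 0])

lemma rotate_in_dihedral_orbit [simp]: "rotate k xs \<in> dihedral_orbit xs"
  unfolding dihedral_orbit_def by auto

lemma dihedral_orbit_mono:
  assumes "ys \<in> dihedral_orbit xs"
  shows "dihedral_orbit ys \<subseteq> dihedral_orbit xs"
  using assms unfolding dihedral_orbit_def
  by (auto simp: rotate_rotate rev_rotate)

lemma dihedral_orbit_sym:
  assumes "ys \<in> dihedral_orbit xs"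
  shows "xs \<in> dihedral_orbit ys"
proof -
  from assms consider k where "ys = rotate k xs" | k where "ys = rotate k (rev xs)"
    unfolding dihedral_orbit_def by blast
  then show ?thesis
  proof cases
    case 1
    then have "xs = rotate (k * length xs - k) ys" by (simp add: rotate_inverse)
    then show ?thesis unfolding dihedral_orbit_def by blast
  next
    case 2
    have "rev xs = rotate (k * length xs - k) ys"
      using 2 rotate_inverse[of k "rev xs"] by simp
    then have "xs = rev (rotate (k * length xs - k) ys)" by (metis rev_rev_ident)
    then show ?thesis unfolding dihedral_orbit_def rev_rotate by blast
  qed
qed

lemma dihedral_orbit_eq_iff: "dihedral_orbit xs = dihedral_orbit ys \<longleftrightarrow> xs \<in> dihedral_orbit ys"
  by (metis dihedral_orbit_mono dihedral_orbit_self dihedral_orbit_sym subset_antisym)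

lemma dihedral_orbit_map: "dihedral_orbit (map f xs) = map f ` dihedral_orbit xs"
  unfolding dihedral_orbit_def by (auto simp: rotate_map rev_map image_iff)

lemma mset_rotate [simp]: "mset (rotate k xs) = mset xs"
proof (induction k)
  case (Suc k)
  have "mset (rotate1 ys) = mset ys" for ys :: "'a list" by (cases ys) auto
  with Suc show ?case by simp
qed simp

lemma dihedral_orbit_mset:
  assumes "ys \<in> dihedral_orbit xs"
  shows "mset ys = mset xs"
  using assms unfolding dihedral_orbit_def by auto

text \<open>The dihedral group acts freely on such lists: the first entry tells rotations apart, and
  a rotation reverses the cyclic direction only if it is preceded by a reversal.\<close>

lemma card_dihedral_orbit:
  assumes "distinct xs" "length xs \<ge> 3"
  shows "card (dihedral_orbit xs) = 2 * length xs"
proof -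
  let ?m = "length xs"
  have inj: "inj_on (\<lambda>k. rotate k ys) {..<?m}" if "distinct ys" "length ys = ?m" for ys :: "'a list"
  proof (rule inj_onI)
    fix k l assume kl: "k \<in> {..<?m}" "l \<in> {..<?m}" "rotate k ys = rotate l ys"
    have "0 < length ys" using assms(2) that by linarith
    then have "rotate j ys ! 0 = ys ! (j mod length ys)" for j
      by (simp add: nth_rotate del: length_greater_0_conv)
    from this[of k] this[of l] have "ys ! k = ys ! l" using kl that by simp
    then show "k = l" using kl that by (simp add: nth_eq_iff_index_eq)
  qed
  have card: "card ((\<lambda>k. rotate k ys) ` {..<?m}) = ?m"
    if "distinct ys" "length ys = ?m" for ys :: "'a list"
    using card_image[OF inj[OF that]] by simp
  have "dihedral_orbit xs = range (\<lambda>k. rotate k xs) \<union> range (\<lambda>k. rotate k (rev xs))"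
    unfolding dihedral_orbit_def by auto
  moreover have "range (\<lambda>k. rotate k ys) = (\<lambda>k. rotate k ys) ` {..<?m}"
    if "length ys = ?m" for ys :: "'a list"
  proof -
    have "rotate k ys \<in> (\<lambda>k. rotate k ys) ` {..<?m}" for k
    proof (rule image_eqI)
      show "rotate k ys = rotate (k mod ?m) ys" using that rotate_conv_mod[of k ys] by simp
      have "?m > 0" using assms(2) by linarith
      then show "k mod ?m \<in> {..<?m}" by (simp del: length_greater_0_conv)
    qed
    then show ?thesis by auto
  qed
  ultimately have eq: "dihedral_orbit xs
      = (\<lambda>k. rotate k xs) ` {..<?m} \<union> (\<lambda>k. rotate k (rev xs)) ` {..<?m}"
    by simp
  have "rotate k xs \<noteq> rotate l (rev xs)" for k l
  proof
    assume eq: "rotate k xs = rotate l (rev xs)"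
    \<comment> \<open>Undoing the rotation by \<open>l\<close> presents \<open>rev xs\<close> as the
      rotation of \<open>xs\<close> by \<open>j\<close>.\<close>
    define j where "j = l * ?m - l + k"
    have "rev xs = rotate j xs"
      using rotate_inverse[of l "rev xs"] by (simp add: j_def rotate_rotate flip: eq)
    then have "rev xs ! i = xs ! ((j + i) mod ?m)" if "i < ?m" for i
      using that by (simp add: nth_rotate)
    then have nth: "xs ! (?m - Suc i) = xs ! ((j + i) mod ?m)" if "i < ?m" for i
      using that by (simp add: rev_nth)
    have *: "?m - Suc i = (j + i) mod ?m" if "i < ?m" for i
    proof -
      have "?m > 0" using that by linarith
      then have "?m - Suc i < ?m" "(j + i) mod ?m < ?m" by (simp_all del: length_greater_0_conv)
      then show ?thesis using nth[OF that] nth_eq_iff_index_eq[OF assms(1)] by blast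
    qed
    \<comment> \<open>From position 0 to position 1 the index drops by one on the left and grows by
      one modulo \<open>?m\<close> on the right, so \<open>?m\<close> would divide 2.\<close>
    have "?m - 1 = j mod ?m" "?m - 2 = Suc j mod ?m"
      using *[of 0] *[of 1] assms(2) by (simp_all add: numeral_2_eq_2 less_le_trans del: length_greater_0_conv)
    then show False using assms(2) by (auto simp: mod_Suc split: if_splits)
  qed
  then show ?thesis
    unfolding eq using assms by (subst card_Un_disjoint) (auto simp: card)
qed

section \<open>From classes of polygons to orbits of tuples\<close>

text \<open>Equivalence depends on the side lengths alone, so each class is the preimage of one
  orbit under \<open>side_lengths\<close>. The injective \<open>map real\<close> then replaces lists
  of reals by lists of natural numbers.\<close>

lemma num_gons_eq_card_orbits:
  "num_gons m n = card (dihedral_orbit ` {xs. map real xs \<in> side_lengths ` integer_gons m n})"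
proof -
  let ?X = "integer_gons m n" and ?s = side_lengths
  define T where "T = {xs. map real xs \<in> ?s ` ?X}"
  let ?r = "{(P, Q). P \<in> ?X \<and> Q \<in> ?X \<and> gon_equivalent P Q}"
  have "?r `` {P} = ?X \<inter> ?s -` dihedral_orbit (?s P)" if "P \<in> ?X" for P
    using that by (auto simp: gon_equivalent_def dihedral_orbit_def)
  then have "?X // ?r = (\<lambda>A. ?X \<inter> ?s -` A) ` dihedral_orbit ` ?s ` ?X"
    unfolding quotient_def by auto
  moreover have "inj_on (\<lambda>A. ?X \<inter> ?s -` A) (dihedral_orbit ` ?s ` ?X)"
  proof (rule inj_onI, clarify)
    fix P Q assume P: "P \<in> ?X" and eq: "?X \<inter> ?s -` dihedral_orbit (?s P) = ?X \<inter> ?s -` dihedral_orbit (?s Q)"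
    have "P \<in> ?X \<inter> ?s -` dihedral_orbit (?s P)" using P by simp
    then have "P \<in> ?X \<inter> ?s -` dihedral_orbit (?s Q)" by (simp only: eq)
    then show "dihedral_orbit (?s P) = dihedral_orbit (?s Q)"
      by (simp add: dihedral_orbit_eq_iff)
  qed
  ultimately have 1: "num_gons m n = card (dihedral_orbit ` ?s ` ?X)"
    unfolding num_gons_def by (simp add: card_image)
  have "\<exists>xs. ?s P = map real xs" if "P \<in> ?X" for P
  proof -
    have "x \<in> \<nat>" if "x \<in> set (?s P)" for x
      using \<open>P \<in> ?X\<close> that unfolding integer_gons_def by (auto simp: Nats_altdef2)
    then have "\<forall>x\<in>set (?s P). \<exists>k. x = real k" by (auto elim!: Nats_cases)
    then obtain f where "\<forall>x\<in>set (?s P). x = real (f x)" by metis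
    then have "?s P = map real (map f (?s P))" by (simp add: map_idI)
    then show ?thesis by blast
  qed
  then have "?s ` ?X = map real ` T" unfolding T_def by (auto simp: image_iff) metis
  then have "dihedral_orbit ` ?s ` ?X = (`) (map real) ` dihedral_orbit ` T"
    by (simp add: image_image dihedral_orbit_map)
  moreover have "inj (map real)" by (simp add: inj_of_nat)
  then have "inj_on ((`) (map real)) (dihedral_orbit ` T)"
    by (meson inj_image_eq_iff inj_onI)
  ultimately show ?thesis
    using 1 by (simp add: card_image T_def)
qed

section \<open>Tuples of side lengths\<close>

definition tuples :: "nat \<Rightarrow> nat \<Rightarrow> nat list set" where
  "tuples m n = {xs. length xs = m \<and> sum_list xs = n}"

text \<open>A superset of the side-length tuples. Admitting zero entries and entries equal to half
  of the sum permits an exact count.\<close>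

definition balanced_tuples :: "nat \<Rightarrow> nat \<Rightarrow> nat list set" where
  "balanced_tuples m n = {xs \<in> tuples m n. \<forall>x\<in>set xs. 2 * x \<le> n}"

text \<open>For \<open>m \<ge> 3\<close>, these are realised by polygons up to rotation and have
  orbits of full size \<open>2 * m\<close>.\<close>

definition generic_tuples :: "nat \<Rightarrow> nat \<Rightarrow> nat list set" where
  "generic_tuples m n = {xs \<in> tuples m n. distinct xs \<and> (\<forall>x\<in>set xs. 0 < x \<and> 2 * x < n)}"

lemma dist_le_sum_dist:
  fixes v :: "nat \<Rightarrow> 'a::metric_space"
  assumes "i \<le> j"
  shows "dist (v i) (v j) \<le> (\<Sum>k=i..<j. dist (v k) (v (Suc k)))"
  using assms
proof (induction j rule: dec_induct)
  case (step j)
  then show ?case using dist_triangle[of "v i" "v (Suc j)" "v j"] by simp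
qed simp

lemma side_length_le_half_perimeter:
  assumes "a \<in> set (side_lengths P)"
  shows "2 * a \<le> perimeter P"
proof -
  let ?d = "\<lambda>k. dist (vertex P k) (vertex P (Suc k))"
  obtain i where i: "i < length P" "a = ?d i"
    using assms by (auto simp: side_lengths_def)
  \<comment> \<open>The other sides form a path between the ends of side \<open>i\<close>; it is cut
    at vertex 0, where the indices wrap around.\<close>
  have "vertex P (length P) = vertex P 0" by (simp add: vertex_def)
  then have "a \<le> dist (vertex P 0) (vertex P i) + dist (vertex P (Suc i)) (vertex P (length P))"
    using i(2) dist_triangle[of "vertex P i" "vertex P (Suc i)" "vertex P 0"]
    by (simp add: dist_commute)
  also have "\<dots> \<le> (\<Sum>k=0..<i. ?d k) + (\<Sum>k=Suc i..<length P. ?d k)"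
    using i by (intro add_mono dist_le_sum_dist) auto
  finally have *: "a \<le> (\<Sum>k=0..<i. ?d k) + (\<Sum>k=Suc i..<length P. ?d k)" .
  have "perimeter P = (\<Sum>k=0..<length P. ?d k)"
    by (simp add: perimeter_def side_lengths_def sum_list_distinct_conv_sum_set)
  also have "\<dots> = (\<Sum>k=0..<i. ?d k) + (\<Sum>k=i..<length P. ?d k)"
    using i by (simp add: sum.atLeastLessThan_concat)
  also have "(\<Sum>k=i..<length P. ?d k) = a + (\<Sum>k=Suc i..<length P. ?d k)"
    using i by (simp add: sum.atLeast_Suc_lessThan)
  finally show ?thesis using * by simp
qed

lemma sum_list_map_real: "sum_list (map real xs) = real (sum_list xs)"
  by (induction xs) auto

lemma side_lengths_subset_balanced:
  "{xs. map real xs \<in> side_lengths ` integer_gons m n} \<subseteq> balanced_tuples m n"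
proof clarify
  fix xs P assume xs: "map real xs = side_lengths P" and P: "P \<in> integer_gons m n"
  have "length (side_lengths P) = m" using P by (simp add: side_lengths_def integer_gons_def)
  then have "length xs = m" by (metis xs length_map)
  moreover have per: "perimeter P = real n" using P by (simp add: integer_gons_def)
  then have "real (sum_list xs) = real n"
    by (simp add: perimeter_def flip: xs sum_list_map_real)
  moreover have "2 * x \<le> n" if "x \<in> set xs" for x
  proof -
    have "real x \<in> set (side_lengths P)" using that by (simp flip: xs)
    then show ?thesis using side_length_le_half_perimeter[of "real x" P] per by simp
  qed
  ultimately show "xs \<in> balanced_tuples m n"
    by (simp add: balanced_tuples_def tuples_def)
qed

text \<open>The comparison is between orbits because the cyclic polygon is built with its longest
  side last, so a rotation of the given tuple is realised.\<close>

lemma orbits_of_generic_subset: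
  assumes "m \<ge> 3"
  shows "dihedral_orbit ` generic_tuples m n
    \<subseteq> dihedral_orbit ` {xs. map real xs \<in> side_lengths ` integer_gons m n}"
proof (rule image_subsetI)
  fix xs assume xs: "xs \<in> generic_tuples m n"
  then have len: "length xs = m" and sum: "sum_list xs = n"
    and pos: "\<And>x. x \<in> set xs \<Longrightarrow> 0 < x \<and> 2 * x < n"
    by (auto simp: generic_tuples_def tuples_def)
  have ne: "set xs \<noteq> {}" using len assms by auto
  then have "Max (set xs) \<in> set xs" by simp
  then obtain i where i: "i < m" "xs ! i = Max (set xs)" using len by (metis in_set_conv_nth)
  \<comment> \<open>Rotation by \<open>Suc i\<close> moves the largest entry from position
    \<open>i\<close> to position \<open>m - 1\<close>.\<close>
  define ys where "ys = rotate (Suc i) xs"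
  have ys: "mset ys = mset xs" "length ys = m" unfolding ys_def by (simp_all only: mset_rotate length_rotate len)
  then have sety: "set ys = set xs" by (metis set_mset_mset)
  have sumy: "sum_list ys = n" using ys(1) sum by (metis sum_mset_sum_list)
  have "last ys = ys ! (m - 1)" using ys assms by (subst last_conv_nth) auto
  also have "\<dots> = xs ! ((Suc i + (m - 1)) mod m)"
    unfolding ys_def using len assms by (subst nth_rotate) auto
  also have "Suc i + (m - 1) = i + m" using assms by simp
  finally have last: "last ys = Max (set xs)" using i by simp
  obtain P where P: "polygon P" "side_lengths P = map real ys"
  proof (rule cyclic_polygon_exists[of "map real ys"])
    have "last (map real ys) = real (last ys)" using ys assms by (subst last_map) auto
    then show "2 * last (map real ys) < sum_list (map real ys)"
      and "\<And>x. x \<in> set (map real ys) \<Longrightarrow> x \<le> last (map real ys)"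
      using pos[OF \<open>Max (set xs) \<in> set xs\<close>]
      by (auto simp: last sum_list_map_real sumy sety)
  qed (use ys assms pos sety in auto)
  have "length P = length (side_lengths P)" by (simp add: side_lengths_def)
  then have "P \<in> integer_gons m n"
    using P pos ys by (simp add: integer_gons_def perimeter_def sum_list_map_real sumy sety)
  then have "ys \<in> {xs. map real xs \<in> side_lengths ` integer_gons m n}"
    using P(2) by (metis image_eqI mem_Collect_eq)
  moreover have "dihedral_orbit xs = dihedral_orbit ys"
    unfolding dihedral_orbit_eq_iff ys_def by (rule dihedral_orbit_sym[OF rotate_in_dihedral_orbit])
  ultimately show "dihedral_orbit xs \<in> dihedral_orbit ` {xs. map real xs \<in> side_lengths ` integer_gons m n}"
    by blast
qed

text \<open>Genericity depends only on the multiset of entries, so the set is a disjoint union of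
  orbits, each with \<open>2 * m\<close> elements.\<close>

lemma card_generic_tuples:
  assumes "m \<ge> 3" "finite (generic_tuples m n)"
  shows "card (generic_tuples m n) = 2 * m * card (dihedral_orbit ` generic_tuples m n)"
proof -
  have closed: "ys \<in> generic_tuples m n" if "xs \<in> generic_tuples m n" "ys \<in> dihedral_orbit xs" for xs ys
  proof -
    have "mset ys = mset xs" using that(2) by (rule dihedral_orbit_mset)
    then have "length ys = length xs" "set ys = set xs" "distinct ys = distinct xs"
        "sum_list ys = sum_list xs"
      by (auto dest: mset_eq_length mset_eq_setD mset_eq_imp_distinct_iff simp flip: sum_mset_sum_list)
    then show ?thesis using that(1) by (simp add: generic_tuples_def tuples_def)
  qed
  have Un: "\<Union> (dihedral_orbit ` generic_tuples m n) = generic_tuples m n"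
    using closed by auto
  have "2 * m * card (dihedral_orbit ` generic_tuples m n) = card (\<Union> (dihedral_orbit ` generic_tuples m n))"
  proof (rule card_partition)
    fix c assume "c \<in> dihedral_orbit ` generic_tuples m n"
    then show "card c = 2 * m"
      using assms(1) by (auto simp: generic_tuples_def tuples_def card_dihedral_orbit)
  next
    fix c d :: "nat list set"
    assume "c \<in> dihedral_orbit ` generic_tuples m n" "d \<in> dihedral_orbit ` generic_tuples m n" "c \<noteq> d"
    then show "c \<inter> d = {}" by (auto simp flip: dihedral_orbit_eq_iff)
  qed (use assms Un in auto)
  then show ?thesis unfolding Un by simp
qed

section \<open>Counting balanced and nongeneric tuples\<close>

lemma finite_tuples [simp]: "finite (tuples m n)"
proof (rule finite_subset)
  show "tuples m n \<subseteq> {xs. set xs \<subseteq> {..n} \<and> length xs = m}"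
    by (auto simp: tuples_def dest: member_le_sum_list)
qed (rule finite_lists_length_eq, simp)

text \<open>Stars and bars, with the lower index independent of \<open>n\<close> as the asymptotics
  require.\<close>

lemma card_tuples:
  assumes "m \<ge> 1"
  shows "card (tuples m n) = (n + (m - 1)) choose (m - 1)"
proof -
  have "card (tuples m n) = (n + m - 1) choose n"
    unfolding tuples_def by (rule card_length_sum_list)
  also have "n + m - 1 = n + (m - 1)" using assms by simp
  also have "(n + (m - 1)) choose n = (n + (m - 1)) choose (m - 1)"
    by (subst binomial_symmetric) auto
  finally show ?thesis .
qed

text \<open>Subtracting \<open>h\<close> from entry \<open>i\<close> is a bijection, inverted by
  adding \<open>h\<close> back.\<close>

lemma card_tuples_entry_ge:
  assumes "i < m" "h \<le> n"
  shows "card {xs \<in> tuples m n. h \<le> xs ! i} = card (tuples m (n - h))"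
proof (rule bij_betw_same_card)
  show "bij_betw (\<lambda>xs. xs[i := xs ! i - h]) {xs \<in> tuples m n. h \<le> xs ! i} (tuples m (n - h))"
    using assms
    by (intro bij_betw_byWitness[where f' = "\<lambda>xs. xs[i := xs ! i + h]"])
       (auto simp: tuples_def sum_list_update elem_le_sum_list)
qed

text \<open>Two entries above \<open>n / 2\<close> would exceed the sum, so the sets
  \<open>H i\<close> of tuples whose entry \<open>i\<close> is too large are disjoint and their
  sizes simply add up. \<open>n \<ge> 1\<close> ensures that
  \<open>Suc (n div 2) \<le> n\<close>.\<close>

lemma card_balanced_tuples:
  assumes "m \<ge> 1" "n \<ge> 1"
  shows "card (balanced_tuples m n) + m * card (tuples m (n - Suc (n div 2))) = card (tuples m n)"
proof -
  define H where "H = (\<lambda>i. {xs \<in> tuples m n. Suc (n div 2) \<le> xs ! i})"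
  have bal: "balanced_tuples m n = tuples m n - (\<Union>i<m. H i)"
  proof -
    have "2 * x \<le> n \<longleftrightarrow> \<not> Suc (n div 2) \<le> x" for x by presburger
    then show ?thesis
      by (auto simp: balanced_tuples_def H_def tuples_def all_set_conv_all_nth)
  qed
  have sub: "(\<Union>i<m. H i) \<subseteq> tuples m n" by (auto simp: H_def)
  have "card (balanced_tuples m n) + card (\<Union>i<m. H i) = card (tuples m n)"
    using card_mono[OF finite_tuples sub] card_Diff_subset[OF finite_subset[OF sub finite_tuples] sub]
    unfolding bal by linarith
  moreover have "card (\<Union>i<m. H i) = (\<Sum>i<m. card (H i))"
  proof (rule card_UN_disjoint)
    show "\<forall>i\<in>{..<m}. finite (H i)" by (auto simp: H_def)
    show "\<forall>i\<in>{..<m}. \<forall>j\<in>{..<m}. i \<noteq> j \<longrightarrow> H i \<inter> H j = {}"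
    proof (intro ballI impI equals0I)
      fix i j xs assume ij: "i \<in> {..<m}" "j \<in> {..<m}" "i \<noteq> j" and "xs \<in> H i \<inter> H j"
      then have xs: "length xs = m" "sum_list xs = n" "Suc (n div 2) \<le> xs ! i" "Suc (n div 2) \<le> xs ! j"
        by (auto simp: H_def tuples_def)
      have "xs ! i + xs ! j = (\<Sum>k\<in>{i, j}. xs ! k)" using ij by simp
      also have "\<dots> \<le> (\<Sum>k\<in>{0..<m}. xs ! k)" using ij by (intro sum_mono2) auto
      also have "\<dots> = n" using xs by (simp add: sum_list_sum_nth)
      finally show False using xs by presburger
    qed
  qed simp
  moreover have "(\<Sum>i<m. card (H i)) = m * card (tuples m (n - Suc (n div 2)))"
    unfolding H_def using assms by (simp add: card_tuples_entry_ge)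
  ultimately show ?thesis by simp
qed

text \<open>The entries outside \<open>j\<close> and \<open>l\<close> determine entry
  \<open>j\<close> by \<open>det\<close>, and then entry \<open>l\<close> by the sum. Hence
  \<open>A\<close> embeds into the functions from \<open>m - 2\<close> positions to
  \<open>{..n}\<close>.\<close>

lemma card_determined_tuples:
  assumes "A \<subseteq> tuples m n" "j < m" "l < m" "j \<noteq> l"
    and det: "\<And>xs ys. xs \<in> A \<Longrightarrow> ys \<in> A \<Longrightarrow> (\<And>k. k < m \<Longrightarrow> k \<noteq> j \<Longrightarrow> k \<noteq> l \<Longrightarrow> xs ! k = ys ! k)
      \<Longrightarrow> xs ! j = ys ! j"
  shows "card A \<le> (n + 1) ^ (m - 2)"
proof -
  let ?K = "{..<m} - {j, l}"
  let ?f = "\<lambda>xs. restrict ((!) xs) ?K"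
  have "card A \<le> card (?K \<rightarrow>\<^sub>E {..n})"
  proof (rule card_inj_on_le)
    show "inj_on ?f A"
    proof (rule inj_onI)
      fix xs ys assume A: "xs \<in> A" "ys \<in> A" and eq: "?f xs = ?f ys"
      then have len: "length xs = m" "length ys = m" and sum: "sum_list xs = sum_list ys"
        using assms(1) by (auto simp: tuples_def)
      have eqK: "xs ! k = ys ! k" if "k \<in> ?K" for k
        using fun_cong[OF eq, of k] that by simp
      then have eqj: "xs ! j = ys ! j" using A by (intro det) auto
      have split: "sum_list zs = zs ! l + (\<Sum>k\<in>{..<m} - {l}. zs ! k)" if "length zs = m" for zs :: "nat list"
        using that assms(3) by (simp add: sum_list_sum_nth atLeast0LessThan sum.remove)
      have "(\<Sum>k\<in>{..<m} - {l}. xs ! k) = (\<Sum>k\<in>{..<m} - {l}. ys ! k)"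
        using eqK eqj by (intro sum.cong) auto
      then have "xs ! l = ys ! l" using split[OF len(1)] split[OF len(2)] sum by simp
      then show "xs = ys" using eqK eqj len by (intro nth_equalityI) auto
    qed
    show "?f ` A \<subseteq> ?K \<rightarrow>\<^sub>E {..n}"
    proof (rule image_subsetI, rule restrict_PiE_iff[THEN iffD2], rule ballI)
      fix xs k assume "xs \<in> A" "k \<in> ?K"
      then show "xs ! k \<in> {..n}"
        using assms(1) elem_le_sum_list[of k xs] by (auto simp: tuples_def)
    qed
    show "finite (?K \<rightarrow>\<^sub>E {..n})" by (intro finite_PiE) auto
  qed
  also have "\<dots> = (n + 1) ^ card ?K" by (simp add: card_PiE)
  also have "card ?K = m - 2" using assms by (simp add: card_Diff_subset)
  finally show ?thesis .
qed

lemma card_tuples_entry_eq: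
  assumes "m \<ge> 2" "i < m"
  shows "card {xs \<in> tuples m n. xs ! i = c} \<le> (n + 1) ^ (m - 2)"
proof -
  obtain l where "l < m" "i \<noteq> l"
    using assms that[of "if i = 0 then 1 else 0"] by (auto split: if_splits)
  then show ?thesis using assms by (intro card_determined_tuples[where j = i and l = l]) auto
qed

lemma card_tuples_entries_eq:
  assumes "m \<ge> 3" "i < m" "j < m" "i \<noteq> j"
  shows "card {xs \<in> tuples m n. xs ! i = xs ! j} \<le> (n + 1) ^ (m - 2)"
proof -
  \<comment> \<open>A third position \<open>l\<close> is needed to be recovered from the sum, while
    entry \<open>j\<close> is copied from entry \<open>i\<close>.\<close>
  have "card {i, j} < card {..<m}" using assms by simp
  then have "{..<m} - {i, j} \<noteq> {}"
    by (metis Diff_eq_empty_iff card_mono finite.intros leD)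
  then obtain l where "l < m" "l \<noteq> i" "l \<noteq> j" by auto
  then show ?thesis using assms
    by (intro card_determined_tuples[where j = j and l = l]) force+
qed

lemma generic_subset_balanced: "generic_tuples m n \<subseteq> balanced_tuples m n"
  by (auto simp: generic_tuples_def balanced_tuples_def)

text \<open>A union bound: at most \<open>m * m\<close> pairs of positions for equal entries, and
  \<open>m\<close> positions each for the values 0 and \<open>n div 2\<close>.\<close>

lemma card_nongeneric_tuples:
  assumes "m \<ge> 3"
  shows "card (balanced_tuples m n - generic_tuples m n) \<le> (m * m + 2 * m) * (n + 1) ^ (m - 2)"
proof -
  define I where "I = {(i, j). i < m \<and> j < m \<and> i \<noteq> j}"
  define E where "E = (\<lambda>(i, j). {xs \<in> tuples m n. xs ! i = xs ! j})"
  define Z where "Z = (\<lambda>c i. {xs \<in> tuples m n. xs ! i = c})"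
  have I: "finite I" "card I \<le> m * m"
  proof -
    have "I \<subseteq> {..<m} \<times> {..<m}" by (auto simp: I_def)
    then show "finite I" "card I \<le> m * m"
      using finite_subset card_mono[of "{..<m} \<times> {..<m}" I] by (auto simp: card_cartesian_product)
  qed
  have "balanced_tuples m n - generic_tuples m n \<subseteq> (\<Union>p\<in>I. E p) \<union> ((\<Union>i<m. Z 0 i) \<union> (\<Union>i<m. Z (n div 2) i))"
  proof
    fix xs assume xs: "xs \<in> balanced_tuples m n - generic_tuples m n"
    then have t: "xs \<in> tuples m n" and len: "length xs = m" by (auto simp: balanced_tuples_def tuples_def)
    \<comment> \<open>Given \<open>2 * x \<le> n\<close>, failure of \<open>2 * x < n\<close> forces
      \<open>x = n div 2\<close>.\<close>
    from xs consider "\<not> distinct xs" | x where "x \<in> set xs" "x = 0 \<or> x = n div 2"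
      by (force simp: balanced_tuples_def generic_tuples_def)
    then show "xs \<in> (\<Union>p\<in>I. E p) \<union> ((\<Union>i<m. Z 0 i) \<union> (\<Union>i<m. Z (n div 2) i))"
    proof cases
      case 1
      then obtain i j where "(i, j) \<in> I" "xs ! i = xs ! j"
        using len by (auto simp: distinct_conv_nth I_def)
      then show ?thesis using t by (auto simp: E_def)
    next
      case 2
      then show ?thesis using t len by (auto simp: Z_def in_set_conv_nth)
    qed
  qed
  then have "card (balanced_tuples m n - generic_tuples m n)
      \<le> card ((\<Union>p\<in>I. E p) \<union> ((\<Union>i<m. Z 0 i) \<union> (\<Union>i<m. Z (n div 2) i)))"
    using I by (intro card_mono) (auto simp: E_def Z_def)
  also have "\<dots> \<le> card (\<Union>p\<in>I. E p) + (card (\<Union>i<m. Z 0 i) + card (\<Union>i<m. Z (n div 2) i))"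
    by (meson add_left_mono card_Un_le order_trans)
  also have "\<dots> \<le> (\<Sum>p\<in>I. card (E p)) + ((\<Sum>i<m. card (Z 0 i)) + (\<Sum>i<m. card (Z (n div 2) i)))"
    using I by (intro add_mono card_UN_le) auto
  also have "\<dots> \<le> (\<Sum>p\<in>I. (n + 1) ^ (m - 2)) + ((\<Sum>i<m. (n + 1) ^ (m - 2)) + (\<Sum>i<m. (n + 1) ^ (m - 2)))"
    using assms
    by (intro add_mono sum_mono)
       (auto simp: E_def Z_def I_def intro!: card_tuples_entry_eq[simplified] card_tuples_entries_eq[simplified])
  also have "\<dots> = (card I + 2 * m) * (n + 1) ^ (m - 2)"
    by (simp add: algebra_simps)
  also have "\<dots> \<le> (m * m + 2 * m) * (n + 1) ^ (m - 2)"
    using I by (intro mult_right_mono) auto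
  finally show ?thesis .
qed

text \<open>The orbits of side-length tuples lie between the generic and the balanced ones. The
  second bound charges a whole weight \<open>2 * m\<close> to each nongeneric tuple, since its orbit
  may be smaller.\<close>

lemma num_gons_bounds:
  assumes "m \<ge> 3"
  shows "card (balanced_tuples m n) \<le> 2 * m * num_gons m n + card (balanced_tuples m n - generic_tuples m n)"
    and "2 * m * num_gons m n \<le> card (balanced_tuples m n) + 2 * m * card (balanced_tuples m n - generic_tuples m n)"
proof -
  let ?O = dihedral_orbit and ?B = "balanced_tuples m n" and ?G = "generic_tuples m n"
  have fin: "finite ?B" "finite ?G" by (auto simp: balanced_tuples_def generic_tuples_def)
  have B: "card ?B = card ?G + card (?B - ?G)"
    using card_Diff_subset[OF fin(2) generic_subset_balanced] card_mono[OF fin(1) generic_subset_balanced]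
    by simp
  have G: "card ?G = 2 * m * card (?O ` ?G)" using card_generic_tuples[OF assms fin(2)] .
  have "card (?O ` ?G) \<le> num_gons m n"
    unfolding num_gons_eq_card_orbits
    using finite_subset[OF side_lengths_subset_balanced fin(1)]
    by (intro card_mono orbits_of_generic_subset assms) auto
  then have "card ?G \<le> 2 * m * num_gons m n" unfolding G by (rule mult_le_mono2)
  then show "card ?B \<le> 2 * m * num_gons m n + card (?B - ?G)" using B by simp
  have "num_gons m n \<le> card (?O ` ?B)"
    unfolding num_gons_eq_card_orbits
    using fin by (intro card_mono image_mono side_lengths_subset_balanced) auto
  also have "?B = ?G \<union> (?B - ?G)" using generic_subset_balanced by blast
  then have "card (?O ` ?B) \<le> card (?O ` ?G) + card (?O ` (?B - ?G))"
    by (metis card_Un_le image_Un)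
  also have "\<dots> \<le> card (?O ` ?G) + card (?B - ?G)"
    using fin by (intro add_left_mono card_image_le) auto
  finally have "2 * m * num_gons m n \<le> 2 * m * (card (?O ` ?G) + card (?B - ?G))"
    by (rule mult_le_mono2)
  also have "\<dots> = card ?G + 2 * m * card (?B - ?G)" using G by (simp add: distrib_left)
  also have "\<dots> \<le> card ?B + 2 * m * card (?B - ?G)" using B by simp
  finally show "2 * m * num_gons m n \<le> card ?B + 2 * m * card (?B - ?G)" .
qed

section \<open>Asymptotics\<close>

text \<open>The binomial coefficient is a product of \<open>k\<close> factors
  \<open>q n + 1 + i\<close> divided by \<open>fact k\<close>, and each factor over \<open>n\<close>
  tends to \<open>c\<close>.\<close>

lemma tendsto_binomial_over_power:
  fixes q :: "nat \<Rightarrow> nat"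
  assumes "(\<lambda>n. real (q n) / real n) \<longlonglongrightarrow> c"
  shows "(\<lambda>n. real ((q n + k) choose k) / real n ^ k) \<longlonglongrightarrow> c ^ k / fact k"
proof -
  have "real ((q n + k) choose k) / real n ^ k = (\<Prod>i<k. real (q n) / real n + (1 + real i) / real n) / fact k" for n
  proof -
    have "real ((q n + k) choose k) = pochhammer (real (q n) + 1) k / fact k"
      by (simp add: binomial_gbinomial gbinomial_pochhammer')
    also have "\<dots> / real n ^ k = (\<Prod>i<k. (real (q n) + 1 + real i) / real n) / fact k"
      by (simp add: pochhammer_prod prod_dividef atLeast0LessThan)
    finally show ?thesis by (simp add: add_divide_distrib add.assoc)
  qed
  moreover have "(\<lambda>n. (\<Prod>i<k. real (q n) / real n + (1 + real i) / real n) / fact k)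
      \<longlonglongrightarrow> (\<Prod>i<k. c + 0) / fact k"
    by (intro tendsto_intros assms lim_const_over_n) auto
  ultimately show ?thesis by simp
qed

lemma tendsto_card_balanced_tuples:
  assumes "m \<ge> 1"
  shows "(\<lambda>n. real (card (balanced_tuples m n)) / real n ^ (m - 1))
    \<longlonglongrightarrow> 1 / fact (m - 1) - real m * ((1 / 2) ^ (m - 1) / fact (m - 1))"
proof -
  let ?k = "m - 1"
  have "(\<lambda>n. real n / real n) \<longlonglongrightarrow> 1"
    by (rule tendsto_eventually) (auto intro: eventually_mono[OF eventually_gt_at_top[of 0]])
  from tendsto_binomial_over_power[OF this, of ?k]
  have 1: "(\<lambda>n. real (card (tuples m n)) / real n ^ ?k) \<longlonglongrightarrow> 1 / fact ?k"
    using assms by (simp add: card_tuples)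
  \<comment> \<open>Rounding is harmless: the numerator lies between \<open>n / 2 - 1\<close> and
    \<open>n / 2\<close>.\<close>
  have "(\<lambda>n. real (n - Suc (n div 2)) / real n) \<longlonglongrightarrow> 1 / 2"
  proof (rule tendsto_sandwich)
    show "(\<lambda>n. 1 / 2 - 1 / real n) \<longlonglongrightarrow> 1 / 2"
      using tendsto_diff[OF tendsto_const[of "1 / 2 :: real"] lim_const_over_n[of "1 :: real"]] by simp
    show "\<forall>\<^sub>F n in sequentially. 1 / 2 - 1 / real n \<le> real (n - Suc (n div 2)) / real n"
      using eventually_gt_at_top[of 0]
    proof eventually_elim
      case (elim n)
      have "n \<le> 2 * (n - Suc (n div 2)) + 2" by presburger
      then have "real n \<le> 2 * real (n - Suc (n div 2)) + 2" by linarith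
      then show ?case using elim by (simp add: field_simps)
    qed
    show "\<forall>\<^sub>F n in sequentially. real (n - Suc (n div 2)) / real n \<le> 1 / 2"
      using eventually_gt_at_top[of 0]
    proof eventually_elim
      case (elim n)
      have "2 * (n - Suc (n div 2)) \<le> n" by presburger
      then have "2 * real (n - Suc (n div 2)) \<le> real n" by linarith
      then show ?case using elim by (simp add: field_simps)
    qed
  qed simp
  from tendsto_binomial_over_power[OF this, of ?k]
  have 2: "(\<lambda>n. real (card (tuples m (n - Suc (n div 2)))) / real n ^ ?k) \<longlonglongrightarrow> (1 / 2) ^ ?k / fact ?k"
    using assms by (simp add: card_tuples)
  have "\<forall>\<^sub>F n in sequentially.
      real (card (tuples m n)) / real n ^ ?k - real m * (real (card (tuples m (n - Suc (n div 2)))) / real n ^ ?k)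
      = real (card (balanced_tuples m n)) / real n ^ ?k"
    using eventually_ge_at_top[of 1]
  proof eventually_elim
    case (elim n)
    show ?case
      using card_balanced_tuples[OF assms elim, symmetric] by (simp add: add_divide_distrib)
  qed
  from Lim_transform_eventually[OF tendsto_diff[OF 1 tendsto_mult_left[OF 2, of "real m"]] this]
  show ?thesis .
qed

lemma tendsto_card_nongeneric_tuples:
  assumes "m \<ge> 3"
  shows "(\<lambda>n. real (card (balanced_tuples m n - generic_tuples m n)) / real n ^ (m - 1)) \<longlonglongrightarrow> 0"
proof (rule tendsto_sandwich[where f = "\<lambda>_. 0"])
  let ?C = "real (m * m + 2 * m) * 2 ^ (m - 2)"
  show "(\<lambda>n. ?C / real n) \<longlonglongrightarrow> 0" by (rule lim_const_over_n)
  show "\<forall>\<^sub>F n in sequentially.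
      real (card (balanced_tuples m n - generic_tuples m n)) / real n ^ (m - 1) \<le> ?C / real n"
    using eventually_ge_at_top[of 1]
  proof eventually_elim
    case (elim n)
    have "real (card (balanced_tuples m n - generic_tuples m n)) \<le> real ((m * m + 2 * m) * (n + 1) ^ (m - 2))"
      using card_nongeneric_tuples[OF assms] by (rule of_nat_mono)
    also have "\<dots> = real (m * m + 2 * m) * (real n + 1) ^ (m - 2)" by (simp add: add.commute)
    also have "\<dots> \<le> real (m * m + 2 * m) * (2 * real n) ^ (m - 2)"
      using elim by (intro mult_left_mono power_mono) auto
    also have "\<dots> = ?C * real n ^ (m - 2)" by (simp add: power_mult_distrib)
    finally have "real (card (balanced_tuples m n - generic_tuples m n)) / real n ^ (m - 1)
        \<le> ?C * real n ^ (m - 2) / real n ^ (m - 1)"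
      by (rule divide_right_mono) simp
    also have "\<dots> = ?C / real n"
    proof -
      have "m - 1 = Suc (m - 2)" using assms by simp
      then show ?thesis using elim by simp
    qed
    finally show ?case .
  qed
qed auto

theorem theorem1p8:
  fixes m :: nat
  assumes "m \<ge> 3"
  shows "(\<lambda>n::nat. real (num_gons m n)) \<sim>[at_top]
           (\<lambda>n. (2 ^ (m - 1) - real m) / (2 ^ m * fact m) * real n ^ (m - 1))"
proof (rule asymp_equivI'_const)
  let ?k = "m - 1"
  let ?B = "\<lambda>n. real (card (balanced_tuples m n)) / real n ^ ?k"
  let ?E = "\<lambda>n. real (card (balanced_tuples m n - generic_tuples m n)) / real n ^ ?k"
  let ?L = "1 / fact ?k - real m * ((1 / 2) ^ ?k / fact ?k)"
  have B: "?B \<longlonglongrightarrow> ?L" using assms by (intro tendsto_card_balanced_tuples) auto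
  have E: "?E \<longlonglongrightarrow> 0" by (rule tendsto_card_nongeneric_tuples[OF assms])
  have "(\<lambda>n. 2 * real m * (real (num_gons m n) / real n ^ ?k)) \<longlonglongrightarrow> ?L"
  proof (rule tendsto_sandwich)
    show "(\<lambda>n. ?B n - ?E n) \<longlonglongrightarrow> ?L" using tendsto_diff[OF B E] by simp
    show "(\<lambda>n. ?B n + 2 * real m * ?E n) \<longlonglongrightarrow> ?L"
      using tendsto_add[OF B tendsto_mult_left[OF E, of "2 * real m"]] by simp
    have "real (card (balanced_tuples m n))
        \<le> 2 * real m * real (num_gons m n) + real (card (balanced_tuples m n - generic_tuples m n))" for n
      using of_nat_mono[OF num_gons_bounds(1)[OF assms, of n], where ?'a = real] by simp
    from divide_right_mono[OF this, of "real _ ^ ?k"]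
    show "\<forall>\<^sub>F n in sequentially. ?B n - ?E n \<le> 2 * real m * (real (num_gons m n) / real n ^ ?k)"
      by (intro always_eventually) (simp add: add_divide_distrib algebra_simps)
    have "2 * real m * real (num_gons m n)
        \<le> real (card (balanced_tuples m n)) + 2 * real m * real (card (balanced_tuples m n - generic_tuples m n))" for n
      using of_nat_mono[OF num_gons_bounds(2)[OF assms, of n], where ?'a = real] by simp
    from divide_right_mono[OF this, of "real _ ^ ?k"]
    show "\<forall>\<^sub>F n in sequentially. 2 * real m * (real (num_gons m n) / real n ^ ?k) \<le> ?B n + 2 * real m * ?E n"
      by (intro always_eventually) (simp add: add_divide_distrib algebra_simps)
  qed
  from tendsto_mult_left[OF this, of "1 / (2 * real m)"]
  have "(\<lambda>n. real (num_gons m n) / real n ^ ?k) \<longlonglongrightarrow> 1 / (2 * real m) * ?L"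
    using assms by simp
  \<comment> \<open>The factor \<open>m\<close> completes \<open>fact (m - 1)\<close> to
    \<open>fact m\<close>, and the factor 2 completes \<open>2 ^ (m - 1)\<close> to
    \<open>2 ^ m\<close>.\<close>
  also have "1 / (2 * real m) * ?L = (2 ^ (m - 1) - real m) / (2 ^ m * fact m)"
    using assms by (cases m) (simp_all add: field_simps)
  finally show "(\<lambda>n. real (num_gons m n) / real n ^ (m - 1))
      \<longlonglongrightarrow> (2 ^ (m - 1) - real m) / (2 ^ m * fact m)" .
  \<comment> \<open>Asymptotic equivalence is obtained from the limit of the quotient only if that
    limit is nonzero. The induction starts at 3, where \<open>3 < 4\<close>.\<close>
  have "m < 2 ^ (m - 1)"
    using assms
  proof (induction m rule: dec_induct)
    case (step k)
    then have "(2::nat) ^ (Suc k - 1) = 2 * 2 ^ (k - 1)" by (cases k) auto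
    with step show ?case by simp
  qed simp
  then have "real m < 2 ^ (m - 1)" by (metis of_nat_less_numeral_power_cancel_iff)
  then show "(2 ^ (m - 1) - real m) / (2 ^ m * fact m) \<noteq> 0" by simp
qed

end
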